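(* Let $n\ge 3$ and $r\ge n-3$ be integers, let $C_n$ be the cyclic graph on $[n]$ and $K_{n+r}$ the complete graph on $[n+r]$. Then \[ \mathrm{Inc}(\mathbb{N})_{n,n+r}(I(C_n)) = I(K_{n+r}). \]
   Context: Let $k$ be a field, $R_m=k[x_1,\dots,x_m]$ and $[m]=\{1,\dots,m\}$. For $n\le m$, $\mathrm{Inc}(\mathbb{N})_{n,m}$ is the set of strictly increasing functions $\pi:[n]\to[m]$; each such $\pi$ induces the $k$-algebra homomorphism $\pi:R_n\to R_m$, $x_i\mapsto x_{\pi(i)}$. For an ideal $I\subseteq R_n$, $\mathrm{Inc}(\mathbb{N})_{n,m}(I):=\sum_{\pi\in\mathrm{Inc}(\mathbb{N})_{n,m}}\pi(I)R_m$, the ideal of $R_m$ generated by the images of $I$ under all such $\pi$. The edge ideal of a simple graph $G$ on $[n]$ is $I(G)=(x_ix_j : \{i,j\}\in E(G))\subseteq R_n$. The cyclic graph $C_n$ ($n\ge 3$) on vertex set $[n]$ has edges $\{i,i+1\}$ for $1\le i\le n-1$ together with $\{1,n\}$. *)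

theory Defs
  imports "HOL-Algebra.RingHom" "HOL-Library.Poly_Mapping" "HOL-Library.FuncSet"
begin

section \<open>The polynomial rings \<open>R\<^sub>m = k[x\<^sub>1, \<dots>, x\<^sub>m]\<close>\<close>

text \<open>
  The type \<open>'k mpoly\<close> is the polynomial ring over \<open>'k\<close> in the variables \<open>x\<^sub>0, x\<^sub>1, x\<^sub>2, \<dots>\<close>:
  a monomial is its finitely supported exponent vector, a polynomial a finitely supported
  coefficient function on monomials.  All the rings \<open>R\<^sub>m\<close> live inside this one type; \<open>x\<^sub>0\<close> is
  never used.
\<close>

type_synonym 'k mpoly = "(nat \<Rightarrow>\<^sub>0 nat) \<Rightarrow>\<^sub>0 'k"

definition var :: "nat \<Rightarrow> 'k::field mpoly" where
  "var i = Poly_Mapping.single (Poly_Mapping.single i 1) 1"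

definition const :: "'k::field \<Rightarrow> 'k mpoly" where
  "const c = Poly_Mapping.single 0 c"

definition vars :: "'k::field mpoly \<Rightarrow> nat set" where
  "vars p = (\<Union>t \<in> Poly_Mapping.keys p. Poly_Mapping.keys t)"

definition poly_ring :: "nat \<Rightarrow> 'k::field mpoly ring" where
  "poly_ring m =
    \<lparr>carrier = {p. vars p \<subseteq> {1..m}}, monoid.mult = (*), one = 1, ring.zero = 0, add = (+)\<rparr>"


section \<open>The action of increasing maps\<close>

definition Inc :: "nat \<Rightarrow> nat \<Rightarrow> (nat \<Rightarrow> nat) set" where
  "Inc n m = {\<pi> \<in> {1..n} \<rightarrow>\<^sub>E {1..m}. strict_mono_on {1..n} \<pi>}"

definition rename :: "(nat \<Rightarrow> nat) \<Rightarrow> 'k::field mpoly \<Rightarrow> 'k mpoly" where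
  "rename \<pi> p =
    (\<Sum>t \<in> Poly_Mapping.keys p. const (Poly_Mapping.lookup p t) *
       (\<Prod>i \<in> Poly_Mapping.keys t. var (\<pi> i) ^ Poly_Mapping.lookup t i))"

definition Inc_ideal :: "nat \<Rightarrow> nat \<Rightarrow> 'k::field mpoly set \<Rightarrow> 'k mpoly set" where
  "Inc_ideal n m I = genideal (poly_ring m) (\<Union>\<pi> \<in> Inc n m. rename \<pi> ` I)"


section \<open>Edge ideals\<close>

text \<open>A simple graph on \<open>{1..n}\<close> is given by its set of edges, which are two-element sets.\<close>

definition simple_graph_on :: "nat \<Rightarrow> nat set set \<Rightarrow> bool" where
  "simple_graph_on n E \<longleftrightarrow> (\<forall>e \<in> E. e \<subseteq> {1..n} \<and> card e = 2)"

definition edge_ideal :: "nat \<Rightarrow> nat set set \<Rightarrow> 'k::field mpoly set" where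
  "edge_ideal n E = genideal (poly_ring n) {var i * var j | i j. {i, j} \<in> E}"

definition cyclic_graph :: "nat \<Rightarrow> nat set set" where
  "cyclic_graph n = {{i, i + 1} | i. 1 \<le> i \<and> i \<le> n - 1} \<union> {{1, n}}"

definition complete_graph :: "nat \<Rightarrow> nat set set" where
  "complete_graph n = {{i, j} | i j. i \<in> {1..n} \<and> j \<in> {1..n} \<and> i \<noteq> j}"

lemma simple_graph_on_cyclic_graph: "3 \<le> n \<Longrightarrow> simple_graph_on n (cyclic_graph n)"
  unfolding simple_graph_on_def cyclic_graph_def by auto

lemma simple_graph_on_complete_graph: "simple_graph_on n (complete_graph n)"
  unfolding simple_graph_on_def complete_graph_def by auto


section \<open>Well-formedness of the algebraic notions\<close>

lemma vars_add: "vars (p + q) \<subseteq> vars p \<union> vars q"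
  unfolding vars_def using Poly_Mapping.keys_add[of p q] by blast

lemma vars_mult: "vars (p * q) \<subseteq> vars p \<union> vars q"
proof
  fix x assume "x \<in> vars (p * q)"
  then obtain t where t: "t \<in> Poly_Mapping.keys (p * q)" "x \<in> Poly_Mapping.keys t"
    unfolding vars_def by blast
  then obtain a b where "a \<in> Poly_Mapping.keys p" "b \<in> Poly_Mapping.keys q" "t = a + b"
    using keys_mult[of p q] by blast
  with t show "x \<in> vars p \<union> vars q"
    unfolding vars_def using Poly_Mapping.keys_add[of a b] by blast
qed

lemma vars_uminus [simp]: "vars (- p) = vars p"
  unfolding vars_def by (simp add: keys_def uminus_poly_mapping.rep_eq)

lemma vars_0 [simp]: "vars 0 = {}" and vars_1 [simp]: "vars 1 = {}"
  unfolding vars_def by simp_all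

lemma vars_var [simp]: "vars (var i) = {i}"
  unfolding vars_def var_def by simp

lemma vars_const [simp]: "vars (const c) = {}"
  unfolding vars_def const_def by simp

lemma const_mult: "const (a * b) = const a * const b"
  by (simp add: const_def mult_single)

lemma cring_poly_ring: "cring (poly_ring m :: 'k::field mpoly ring)" (is "cring ?R")
proof (rule cringI)
  have add: "p + q \<in> carrier ?R" if "p \<in> carrier ?R" "q \<in> carrier ?R" for p q
    using that vars_add[of p q] unfolding poly_ring_def by auto
  have mult: "p * q \<in> carrier ?R" if "p \<in> carrier ?R" "q \<in> carrier ?R" for p q
    using that vars_mult[of p q] unfolding poly_ring_def by auto
  show "abelian_group ?R"
  proof (rule abelian_groupI)
    fix x :: "'k mpoly"
    assume "x \<in> carrier ?R"
    then show "\<exists>y \<in> carrier ?R. y \<oplus>\<^bsub>?R\<^esub> x = \<zero>\<^bsub>?R\<^esub>"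
      by (intro bexI[of _ "- x"]) (auto simp: poly_ring_def)
  qed (use add in \<open>simp_all add: poly_ring_def add_ac\<close>)
  show "Group.comm_monoid ?R"
    by (rule comm_monoidI) (use mult in \<open>simp_all add: poly_ring_def mult_ac\<close>)
qed (simp add: poly_ring_def distrib_right)

lemma rename_eq_sum:
  assumes "finite A" "Poly_Mapping.keys p \<subseteq> A"
  shows "rename \<pi> p =
    (\<Sum>t \<in> A. const (Poly_Mapping.lookup p t) *
       (\<Prod>i \<in> Poly_Mapping.keys t. var (\<pi> i) ^ Poly_Mapping.lookup t i))"
  unfolding rename_def
  by (rule sum.mono_neutral_left) (use assms in \<open>auto simp: in_keys_iff const_def\<close>)

lemma rename_add: "rename \<pi> (p + q :: 'k::field mpoly) = rename \<pi> p + rename \<pi> q"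
proof -
  let ?A = "Poly_Mapping.keys p \<union> Poly_Mapping.keys q"
  have "rename \<pi> r = (\<Sum>t \<in> ?A. const (Poly_Mapping.lookup r t) *
       (\<Prod>i \<in> Poly_Mapping.keys t. var (\<pi> i) ^ Poly_Mapping.lookup t i))"
    if "Poly_Mapping.keys r \<subseteq> ?A" for r :: "'k mpoly"
    by (rule rename_eq_sum) (use that in auto)
  from this[of p] this[of q] this[OF Poly_Mapping.keys_add] show ?thesis
    by (simp add: lookup_add const_def single_add distrib_right sum.distrib)
qed

lemma rename_0 [simp]: "rename \<pi> 0 = 0"
  by (simp add: rename_def)

lemma rename_sum: "rename \<pi> (sum f A) = (\<Sum>x \<in> A. rename \<pi> (f x))"
  by (induction A rule: infinite_finite_induct) (simp_all add: rename_add)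

lemma rename_single:
  "rename \<pi> (Poly_Mapping.single t c) =
     const c * (\<Prod>i \<in> Poly_Mapping.keys t. var (\<pi> i) ^ Poly_Mapping.lookup t i)"
  by (subst rename_eq_sum[of "{t}"]) auto

lemma rename_const [simp]: "rename \<pi> (const c) = const c"
  unfolding const_def[of c] rename_single by (simp add: const_def)

lemma rename_var [simp]: "rename \<pi> (var i) = var (\<pi> i)"
  unfolding var_def[of i] rename_single by (simp add: const_def)

lemma rename_1 [simp]: "rename \<pi> 1 = 1"
  using rename_const[of \<pi> 1] by (simp add: const_def)

lemma prod_monomial_add:
  fixes f :: "nat \<Rightarrow> 'a::comm_monoid_mult"
  shows "(\<Prod>i \<in> Poly_Mapping.keys (s + t). f i ^ Poly_Mapping.lookup (s + t) i) =
    (\<Prod>i \<in> Poly_Mapping.keys s. f i ^ Poly_Mapping.lookup s i) *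
    (\<Prod>i \<in> Poly_Mapping.keys t. f i ^ Poly_Mapping.lookup t i)"
proof -
  let ?A = "Poly_Mapping.keys s \<union> Poly_Mapping.keys t"
  have "(\<Prod>i \<in> Poly_Mapping.keys u. f i ^ Poly_Mapping.lookup u i) =
      (\<Prod>i \<in> ?A. f i ^ Poly_Mapping.lookup u i)" if "Poly_Mapping.keys u \<subseteq> ?A" for u
    by (rule prod.mono_neutral_left) (use that in \<open>auto simp: in_keys_iff\<close>)
  from this[of s] this[of t] this[OF Poly_Mapping.keys_add] show ?thesis
    by (simp add: lookup_add power_add prod.distrib)
qed

lemma mpoly_sum_single:
  "p = (\<Sum>t \<in> Poly_Mapping.keys p. Poly_Mapping.single t (Poly_Mapping.lookup p t))"
  by (rule poly_mapping_eqI)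
    (auto simp: lookup_sum lookup_single when_def in_keys_iff)

lemma rename_mult: "rename \<pi> (p * q :: 'k::field mpoly) = rename \<pi> p * rename \<pi> q"
proof -
  have single: "rename \<pi> (Poly_Mapping.single s a * Poly_Mapping.single t b) =
      rename \<pi> (Poly_Mapping.single s a) * rename \<pi> (Poly_Mapping.single t b)" for s t and a b :: 'k
    by (simp add: mult_single rename_single prod_monomial_add const_mult mult_ac)
  let ?s = "\<lambda>p :: 'k mpoly. \<lambda>t. Poly_Mapping.single t (Poly_Mapping.lookup p t)"
  have "rename \<pi> ((\<Sum>t \<in> A. ?s p t) * (\<Sum>t \<in> B. ?s q t)) =
      rename \<pi> (\<Sum>t \<in> A. ?s p t) * rename \<pi> (\<Sum>t \<in> B. ?s q t)" for A B
    by (simp only: sum_product rename_sum single)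
  from this[of "Poly_Mapping.keys p" "Poly_Mapping.keys q"] show ?thesis
    by (simp only: mpoly_sum_single[symmetric])
qed

lemma vars_sum: "vars (sum f A) \<subseteq> (\<Union>x \<in> A. vars (f x))"
proof (induction A rule: infinite_finite_induct)
  case (insert x A)
  then show ?case
    using vars_add[of "f x" "sum f A"] by auto
qed simp_all

lemma vars_prod: "vars (prod f A) \<subseteq> (\<Union>x \<in> A. vars (f x))"
proof (induction A rule: infinite_finite_induct)
  case (insert x A)
  then show ?case
    using vars_mult[of "f x" "prod f A"] by auto
qed simp_all

lemma vars_power: "vars (p ^ n) \<subseteq> vars p"
proof (induction n)
  case (Suc n)
  then show ?case
    using vars_mult[of p "p ^ n"] by auto
qed simp

lemma vars_rename: "vars (rename \<pi> (p :: 'k::field mpoly)) \<subseteq> \<pi> ` vars p"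
proof -
  have monomial: "vars (const c * (\<Prod>i \<in> Poly_Mapping.keys t. var (\<pi> i) ^ Poly_Mapping.lookup t i))
      \<subseteq> \<pi> ` Poly_Mapping.keys t" for t and c :: 'k
  proof -
    have "vars (\<Prod>i \<in> Poly_Mapping.keys t. (var (\<pi> i) :: 'k mpoly) ^ Poly_Mapping.lookup t i)
        \<subseteq> (\<Union>i \<in> Poly_Mapping.keys t. vars ((var (\<pi> i) :: 'k mpoly) ^ Poly_Mapping.lookup t i))"
      by (rule vars_prod)
    also have "\<dots> \<subseteq> (\<Union>i \<in> Poly_Mapping.keys t. vars (var (\<pi> i) :: 'k mpoly))"
      by (intro UN_mono vars_power order_refl)
    also have "\<dots> = \<pi> ` Poly_Mapping.keys t"
      by auto
    finally show ?thesis
      using vars_mult by fastforce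
  qed
  have "vars (rename \<pi> p) \<subseteq> (\<Union>t \<in> Poly_Mapping.keys p. \<pi> ` Poly_Mapping.keys t)"
    unfolding rename_def by (rule order_trans[OF vars_sum UN_mono[OF order_refl monomial]])
  then show ?thesis
    unfolding vars_def[of p] by (simp only: image_UN)
qed

text \<open>With \<open>rename_const\<close> and \<open>rename_var\<close>: \<open>rename \<pi>\<close> is the \<open>k\<close>-algebra homomorphism
  \<open>R\<^sub>n \<rightarrow> R\<^sub>m\<close> with \<open>x\<^sub>i \<mapsto> x\<^bsub>\<pi>(i)\<^esub>\<close>.\<close>

lemma rename_ring_hom:
  assumes "\<pi> \<in> Inc n m"
  shows "rename \<pi> \<in> ring_hom (poly_ring n) (poly_ring m :: 'k::field mpoly ring)"
proof (rule ring_hom_memI)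
  fix p :: "'k mpoly"
  assume "p \<in> carrier (poly_ring n)"
  moreover have "\<pi> ` {1..n} \<subseteq> {1..m}"
    using assms unfolding Inc_def by (auto simp del: atLeastAtMost_iff dest: PiE_mem)
  ultimately show "rename \<pi> p \<in> carrier (poly_ring m)"
    using vars_rename[of \<pi> p] unfolding poly_ring_def
    by simp (meson image_mono order_trans)
qed (simp_all add: poly_ring_def rename_mult rename_add)

end

theory Submission
  imports Defs "HOL-Algebra.QuotRing"
begin

text \<open>
  Both sides are generated by monomials \<open>x\<^sub>i x\<^sub>j\<close>, and ring homomorphisms carry generators of
  an ideal to generators of the extended ideal.  Hence for every simple graph the extended ideal is
  again an edge ideal, namely that of the graph of all images \<open>\<pi> ` e\<close> of edges
  (\<open>Inc_ideal_edge_ideal\<close>), and the theorem becomes a statement about graphs: every pair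
  \<open>a < b\<close> in \<open>{1..n + r}\<close> is the image of an edge of the cycle under an increasing map
  (\<open>Inc_images_cyclic_graph\<close>).

  An increasing map sending the edge \<open>{i, i + 1}\<close> to \<open>{a, b}\<close> exists as soon as there is room for
  the remaining vertices: \<open>i - 1\<close> of them below \<open>a\<close>, and \<open>n - i - 1\<close> above \<open>b\<close>.
  A suitable \<open>i\<close> can be found unless \<open>b - a \<ge> r + 2\<close>.  The closing edge \<open>{1, n}\<close> needs
  room for \<open>n - 2\<close> vertices strictly between \<open>a\<close> and \<open>b\<close>, that is \<open>b - a \<ge> n - 1\<close>.
  The hypothesis \<open>r \<ge> n - 3\<close> is what makes the two cases exhaustive.
\<close>

lemma ring_poly_ring: "ring (poly_ring m :: 'k::field mpoly ring)"
  using cring_poly_ring by (rule cring.axioms(1))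

lemma Inc_mem: "\<pi> \<in> Inc n m \<Longrightarrow> i \<in> {1..n} \<Longrightarrow> \<pi> i \<in> {1..m}"
  unfolding Inc_def by (auto simp del: atLeastAtMost_iff dest: PiE_mem)

text \<open>It is enough to move generators: the preimage of an ideal of \<open>R\<^sub>m\<close> under \<open>rename \<pi>\<close> is an
  ideal of \<open>R\<^sub>n\<close>, so it contains the ideal generated by \<open>S\<close> once it contains \<open>S\<close>.\<close>

lemma Inc_ideal_genideal:
  fixes S :: "'k::field mpoly set"
  assumes S: "S \<subseteq> carrier (poly_ring n)"
  shows "Inc_ideal n m (genideal (poly_ring n) S) =
    genideal (poly_ring m) (\<Union>\<pi> \<in> Inc n m. rename \<pi> ` S)"
proof -
  let ?Rn = "poly_ring n :: 'k mpoly ring" and ?Rm = "poly_ring m :: 'k mpoly ring"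
  let ?I = "genideal ?Rn S"
  let ?T = "\<Union>\<pi> \<in> Inc n m. rename \<pi> ` S"
  interpret Rn: ring ?Rn by (rule ring_poly_ring)
  interpret Rm: ring ?Rm by (rule ring_poly_ring)
  have hom: "rename \<pi> p \<in> carrier ?Rm" if "\<pi> \<in> Inc n m" "p \<in> carrier ?Rn" for \<pi> p
    using ring_hom_closed[OF rename_ring_hom[OF that(1)] that(2)] .
  have T: "?T \<subseteq> carrier ?Rm"
    using hom S by blast
  have I: "?I \<subseteq> carrier ?Rn"
    using Rn.genideal_ideal[OF S] by (simp add: additive_subgroup.a_subset ideal.axioms(1))
  have "(\<Union>\<pi> \<in> Inc n m. rename \<pi> ` ?I) \<subseteq> genideal ?Rm ?T"
  proof clarify
    fix \<pi> p assume \<pi>: "\<pi> \<in> Inc n m" and p: "p \<in> ?I"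
    interpret hom: ring_hom_ring ?Rn ?Rm "rename \<pi>"
      by (rule ring_hom_ringI2[OF Rn.ring_axioms Rm.ring_axioms rename_ring_hom[OF \<pi>]])
    have "ideal {x \<in> carrier ?Rn. rename \<pi> x \<in> genideal ?Rm ?T} ?Rn"
      by (rule hom.ideal_vimage[OF Rm.genideal_ideal[OF T]])
    moreover have "S \<subseteq> {x \<in> carrier ?Rn. rename \<pi> x \<in> genideal ?Rm ?T}"
      using S \<pi> Rm.genideal_self[OF T] by blast
    ultimately have "?I \<subseteq> {x \<in> carrier ?Rn. rename \<pi> x \<in> genideal ?Rm ?T}"
      by (rule Rn.genideal_minimal)
    with p show "rename \<pi> p \<in> genideal ?Rm ?T"
      by blast
  qed
  then have "Inc_ideal n m ?I \<subseteq> genideal ?Rm ?T"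
    unfolding Inc_ideal_def by (rule Rm.genideal_minimal[OF Rm.genideal_ideal[OF T]])
  moreover have "genideal ?Rm ?T \<subseteq> Inc_ideal n m ?I"
    unfolding Inc_ideal_def
  proof (rule Rm.subset_Idl_subset)
    show "(\<Union>\<pi> \<in> Inc n m. rename \<pi> ` ?I) \<subseteq> carrier ?Rm"
      using hom I by blast
    show "?T \<subseteq> (\<Union>\<pi> \<in> Inc n m. rename \<pi> ` ?I)"
      using Rn.genideal_self[OF S] by blast
  qed
  ultimately show ?thesis
    by (rule subset_antisym)
qed

definition Inc_images :: "nat \<Rightarrow> nat \<Rightarrow> nat set set \<Rightarrow> nat set set" where
  "Inc_images n m E = {\<pi> ` e | \<pi> e. \<pi> \<in> Inc n m \<and> e \<in> E}"

lemma edge_monomials_subset: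
  assumes "simple_graph_on n E"
  shows "{var i * var j | i j. {i, j} \<in> E} \<subseteq> (carrier (poly_ring n) :: 'k::field mpoly set)"
proof clarify
  fix i j assume "{i, j} \<in> E"
  then have "{i, j} \<subseteq> {1..n}"
    using assms unfolding simple_graph_on_def by blast
  then show "var i * var j \<in> (carrier (poly_ring n) :: 'k mpoly set)"
    using vars_mult[of "var i :: 'k mpoly" "var j"] unfolding poly_ring_def by auto
qed

lemma Inc_ideal_edge_ideal:
  assumes E: "simple_graph_on n E"
  shows "Inc_ideal n m (edge_ideal n E) =
    (edge_ideal m (Inc_images n m E) :: 'k::field mpoly set)"
proof -
  let ?S = "{var i * var j | i j. {i, j} \<in> E} :: 'k mpoly set"
  have "(\<Union>\<pi> \<in> Inc n m. rename \<pi> ` ?S) =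
      {var i * var j | i j. {i, j} \<in> Inc_images n m E}" (is "?L = ?R")
  proof
    show "?L \<subseteq> ?R"
    proof clarify
      fix \<pi> i j assume "\<pi> \<in> Inc n m" "{i, j} \<in> E"
      then have "{\<pi> i, \<pi> j} \<in> Inc_images n m E"
        unfolding Inc_images_def by (metis (mono_tags, lifting) image_empty image_insert mem_Collect_eq)
      then show "\<exists>a b. rename \<pi> (var i * var j :: 'k mpoly) = var a * var b \<and>
          {a, b} \<in> Inc_images n m E"
        unfolding rename_mult rename_var by blast
    qed
    show "?R \<subseteq> ?L"
    proof clarify
      fix a b assume "{a, b} \<in> Inc_images n m E"
      then obtain \<pi> e where \<pi>: "\<pi> \<in> Inc n m" and e: "e \<in> E" "{a, b} = \<pi> ` e"
        unfolding Inc_images_def by blast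
      moreover obtain i j where ij: "e = {i, j}"
        using E e(1) unfolding simple_graph_on_def by (meson card_2_iff)
      \<comment> \<open>The pair \<open>a, b\<close> may come in either order, which the product does not see.\<close>
      ultimately have "a = \<pi> i \<and> b = \<pi> j \<or> a = \<pi> j \<and> b = \<pi> i"
        by (simp add: doubleton_eq_iff)
      then have "var a * var b = rename \<pi> (var i * var j :: 'k mpoly)"
        unfolding rename_mult rename_var by (auto intro: mult.commute)
      then show "var a * var b \<in> ?L"
        using \<pi> e ij by blast
    qed
  qed
  then show ?thesis
    using Inc_ideal_genideal[OF edge_monomials_subset[OF E, where 'k = 'k], of m]
    unfolding edge_ideal_def by simp
qed

lemma restrict_in_Inc:
  assumes "\<And>j. j \<in> {1..n} \<Longrightarrow> f j \<in> {1..m}" "strict_mono_on {1..n} f"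
  shows "restrict f {1..n} \<in> Inc n m"
  using assms unfolding Inc_def strict_mono_on_def by auto

text \<open>The map below leaves the vertices before \<open>i\<close> where they are and places those after \<open>i + 1\<close>
  directly after \<open>b\<close>.\<close>

lemma consecutive_pair_image:
  assumes "1 \<le> i" "i + 1 \<le> n" "i \<le> a" "a < b" "b + n \<le> m + i + 1"
  shows "\<exists>\<pi> \<in> Inc n m. \<pi> ` {i, i + 1} = {a, b}"
proof -
  define f where "f j = (if j < i then j else if j = i then a else b + (j - (i + 1)))" for j
  have "restrict f {1..n} \<in> Inc n m"
    by (rule restrict_in_Inc) (use assms in \<open>auto simp: f_def strict_mono_on_def\<close>)
  moreover have "restrict f {1..n} ` {i, i + 1} = {a, b}"
    using assms by (auto simp: f_def)
  ultimately show ?thesis by blast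
qed

lemma end_pair_image:
  assumes "2 \<le> n" "1 \<le> a" "b \<le> m" "a + n \<le> b + 1"
  shows "\<exists>\<pi> \<in> Inc n m. \<pi> ` {1, n} = {a, b}"
proof -
  define f where "f j = (if j = n then b else a + (j - 1))" for j
  have "restrict f {1..n} \<in> Inc n m"
    by (rule restrict_in_Inc) (use assms in \<open>auto simp: f_def strict_mono_on_def\<close>)
  moreover have "restrict f {1..n} ` {1, n} = {a, b}"
    using assms by (auto simp: f_def)
  ultimately show ?thesis by blast
qed

lemma Inc_images_subset_complete_graph:
  assumes E: "simple_graph_on n E"
  shows "Inc_images n m E \<subseteq> complete_graph m"
proof
  fix d assume "d \<in> Inc_images n m E"
  then obtain \<pi> e where \<pi>: "\<pi> \<in> Inc n m" and e: "e \<in> E" "d = \<pi> ` e"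
    unfolding Inc_images_def by blast
  then have sub: "e \<subseteq> {1..n}" and "card e = 2"
    using E unfolding simple_graph_on_def by blast+
  from this(2) obtain i j where ij: "e = {i, j}" "i \<noteq> j"
    by (auto simp: card_2_iff)
  then have mem: "i \<in> {1..n}" "j \<in> {1..n}"
    using sub by simp_all
  have "inj_on \<pi> {1..n}"
    using \<pi> unfolding Inc_def by (simp add: strict_mono_on_imp_inj_on)
  then have "\<pi> i \<noteq> \<pi> j"
    using ij(2) mem by (simp add: inj_on_eq_iff)
  moreover have "\<pi> i \<in> {1..m}" "\<pi> j \<in> {1..m}"
    using Inc_mem[OF \<pi>] mem by blast+
  ultimately show "d \<in> complete_graph m"
    unfolding e(2) ij(1) complete_graph_def by blast
qed

lemma Inc_images_cyclic_graph:
  assumes n: "3 \<le> n" and r: "n - 3 \<le> r"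
  shows "Inc_images n (n + r) (cyclic_graph n) = complete_graph (n + r)"
proof
  show "Inc_images n (n + r) (cyclic_graph n) \<subseteq> complete_graph (n + r)"
    by (rule Inc_images_subset_complete_graph[OF simple_graph_on_cyclic_graph[OF n]])
  have pair: "{a, b} \<in> Inc_images n (n + r) (cyclic_graph n)"
    if ab: "1 \<le> a" "a < b" "b \<le> n + r" for a b
  proof -
    have "\<exists>\<pi> \<in> Inc n (n + r). \<exists>e \<in> cyclic_graph n. \<pi> ` e = {a, b}"
    proof (cases "b \<le> a + r + 1")
      case True
      \<comment> \<open>The largest \<open>i\<close> with room for \<open>i - 1\<close> vertices below \<open>a\<close> leaves the fewest vertices to
          be placed above \<open>b\<close>.\<close>
      define i where "i = min a (n - 1)"
      have "{i, i + 1} \<in> cyclic_graph n"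
        unfolding cyclic_graph_def
        by (intro UnI1 CollectI exI[of _ i]) (use n ab in \<open>simp add: i_def\<close>)
      moreover have "\<exists>\<pi> \<in> Inc n (n + r). \<pi> ` {i, i + 1} = {a, b}"
        by (rule consecutive_pair_image) (use n ab True in \<open>auto simp: i_def\<close>)
      ultimately show ?thesis by blast
    next
      case False
      have "{1, n} \<in> cyclic_graph n"
        unfolding cyclic_graph_def by blast
      moreover have "\<exists>\<pi> \<in> Inc n (n + r). \<pi> ` {1, n} = {a, b}"
        by (rule end_pair_image) (use n r ab False in auto)
      ultimately show ?thesis by blast
    qed
    then show ?thesis
      unfolding Inc_images_def by blast
  qed
  show "complete_graph (n + r) \<subseteq> Inc_images n (n + r) (cyclic_graph n)"
  proof
    fix e assume "e \<in> complete_graph (n + r)"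
    then obtain a b where ab: "e = {a, b}" "a \<in> {1..n + r}" "b \<in> {1..n + r}" "a \<noteq> b"
      unfolding complete_graph_def by blast
    then show "e \<in> Inc_images n (n + r) (cyclic_graph n)"
      using pair[of a b] pair[of b a] by (cases "a < b") (auto simp: insert_commute)
  qed
qed

theorem lemma3p13:
  fixes n r :: nat
  assumes "n \<ge> 3" and "r \<ge> n - 3"
  shows "Inc_ideal n (n + r) (edge_ideal n (cyclic_graph n)) =
    (edge_ideal (n + r) (complete_graph (n + r)) :: 'k::field mpoly set)"
  unfolding Inc_ideal_edge_ideal[OF simple_graph_on_cyclic_graph[OF assms(1)]]
    Inc_images_cyclic_graph[OF assms] ..

end
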